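(* Let $\preceq$ be the total preorder on $\Omega$ induced by a surjective map $Z:\Omega\to[0,1]$, and let $\underline{E}$ be the natural extension of a p-box $(\underline{F},\overline{F})$ on $(\Omega,\preceq)$, with conjugate $\overline{E}$. Let $A$ be an arbitrary subset of $\Omega$. Then $$\underline{E}(A)=\sum_{\lambda\in\Lambda}\underline{E}(I_\lambda),\qquad \overline{E}(A)=1-\sum_{\lambda\in\Lambda'}\underline{E}(J_\lambda),$$ where $(I_\lambda)_{\lambda\in\Lambda}$ are the full components of $Z(\mathrm{int}(A))=\Gamma_*(A)$ and $(J_\lambda)_{\lambda\in\Lambda'}$ are the full components of $Z(\mathrm{int}(A^c))=Z(\mathrm{cl}(A)^c)=\Gamma_*(A^c)$. If, in addition, $\underline{F}$ is left-continuous as a function of $z\in[0,1]$ and $\underline{F}(0)=0$, then $$\underline{E}(A)=\sum_{\lambda\in\Lambda}\max\{0,\underline{F}(\sup I_\lambda)-\overline{F}(\inf I_\lambda)\},\qquad \overline{E}(A)=1-\sum_{\lambda\in\Lambda'}\max\{0,\underline{F}(\sup J_\lambda)-\overline{F}(\inf J_\lambda)\}.$$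
   Context: $Z:\Omega\to[0,1]$ is surjective and $x\preceq y$ is defined to mean $Z(x)\le Z(y)$; this is a total preorder on $\Omega$. Choose $0_\Omega,1_\Omega\in\Omega$ with $Z(0_\Omega)=0$, $Z(1_\Omega)=1$ (a smallest and a largest element). Write $x\prec y$ if $Z(x)<Z(y)$, $x\simeq y$ if $Z(x)=Z(y)$, and $[x]_\simeq$ for the $\simeq$-equivalence class of $x$. Intervals in $\Omega$: $[x,y]=\{v:x\preceq v\preceq y\}$, $(x,y]=\{v:x\prec v\preceq y\}$, etc. A gamble is a bounded function $\Omega\to\mathbb{R}$; an event is a subset of $\Omega$ and is identified with its indicator. A lower prevision $\underline{P}$ on all gambles is coherent if $\underline{P}(f)\ge\inf f$, $\underline{P}(\lambda f)=\lambda\underline{P}(f)$, $\underline{P}(f+g)\ge\underline{P}(f)+\underline{P}(g)$ for all gambles $f,g$ and real $\lambda\ge0$. A linear prevision is a functional $Q$ on all gambles with $Q(f)\ge\inf f$ and $Q(f+g)=Q(f)+Q(g)$. A cumulative distribution function is a map $F:\Omega\to[0,1]$, non-decreasing with respect to $\preceq$, with $F(1_\Omega)=1$. It is constant on equivalence classes, so it is regarded as a non-decreasing function of $z=Z(x)\in[0,1]$. A p-box is a pair $(\underline{F},\overline{F})$ of cumulative distribution functions with $\underline{F}\le\overline{F}$. The natural extension $\underline{E}$ is the pointwise smallest coherent lower prevision on all gambles with $\underline{E}([0_\Omega,x])=\underline{F}(x)$ and $\underline{E}((y,1_\Omega])=1-\overline{F}(y)$ for all $x,y\in\Omega$; equivalently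 $\underline{E}(f)=\min Q(f)$ over all linear previsions $Q$ with $\underline{F}(x)\le Q([0_\Omega,x])\le\overline{F}(x)$ for all $x\in\Omega$. The conjugate is $\overline{E}(f)=-\underline{E}(-f)$, so $\overline{E}(A)=1-\underline{E}(A^c)$ for events. For $I\subseteq[0,1]$, write $\underline{E}(I)$ for $\underline{E}(Z^{-1}(I))$. In the partition topology on $\Omega$ generated by the equivalence classes: $\mathrm{int}(A)=\bigcup\{[x]_\simeq:[x]_\simeq\subseteq A\}$ and $\mathrm{cl}(A)=\bigcup\{[x]_\simeq:[x]_\simeq\cap A\ne\emptyset\}$. With $\Gamma(z)=Z^{-1}(\{z\})$, $\Gamma_*(A)=\{z\in[0,1]:\Gamma(z)\subseteq A\}$. A subset $S$ of $[0,1]$ is full if $[a,b]\subseteq S$ for all $a\le b$ in $S$; the full component of $z$ in $T\subseteq[0,1]$ ($z\in T$) is the largest full set $S$ with $z\in S\subseteq T$; the full components of $T$ partition $T$. The sum of a possibly infinite family of non-negative reals is the supremum of its finite partial sums.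
   Formalization: In the last two formulas, for a component containing 0 the subtracted upper CDF value at inf is taken as 0 (not its value at 0), as the literal formula fails, e.g. for A=Ω with upper CDF constantly 1; the literal formulas are proved if the upper CDF vanishes at 0 or no component contains 0. *)

theory Defs
  imports "HOL-Analysis.Analysis"
begin

section \<open>Lower previsions\<close>

definition gamble :: "('a \<Rightarrow> real) \<Rightarrow> bool" where
  "gamble f \<longleftrightarrow> bounded (range f)"

text \<open>Functionals are total on \<open>'a \<Rightarrow> real\<close>; only their values on gambles carry meaning.\<close>

definition coherent_lower_prevision :: "(('a \<Rightarrow> real) \<Rightarrow> real) \<Rightarrow> bool" where
  "coherent_lower_prevision P \<longleftrightarrow>
     (\<forall>f. gamble f \<longrightarrow> P f \<ge> (INF x. f x)) \<and>
     (\<forall>f c. gamble f \<longrightarrow> c \<ge> 0 \<longrightarrow> P (\<lambda>x. c * f x) = c * P f) \<and>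
     (\<forall>f g. gamble f \<longrightarrow> gamble g \<longrightarrow> P (\<lambda>x. f x + g x) \<ge> P f + P g)"

definition conjugate :: "(('a \<Rightarrow> real) \<Rightarrow> real) \<Rightarrow> ('a \<Rightarrow> real) \<Rightarrow> real" where
  "conjugate P f = - P (\<lambda>x. - f x)"

definition on_event :: "(('a \<Rightarrow> real) \<Rightarrow> real) \<Rightarrow> 'a set \<Rightarrow> real" where
  "on_event P A = P (indicator A)"

section \<open>The preorder induced by \<open>Z\<close>\<close>

definition preceq :: "('a \<Rightarrow> real) \<Rightarrow> 'a \<Rightarrow> 'a \<Rightarrow> bool" where
  "preceq Z x y \<longleftrightarrow> Z x \<le> Z y"

definition prec :: "('a \<Rightarrow> real) \<Rightarrow> 'a \<Rightarrow> 'a \<Rightarrow> bool" where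
  "prec Z x y \<longleftrightarrow> Z x < Z y"

definition eq_class :: "('a \<Rightarrow> real) \<Rightarrow> 'a \<Rightarrow> 'a set" where
  "eq_class Z x = {y. Z y = Z x}"

definition closed_interval :: "('a \<Rightarrow> real) \<Rightarrow> 'a \<Rightarrow> 'a \<Rightarrow> 'a set" where
  "closed_interval Z x y = {v. preceq Z x v \<and> preceq Z v y}"

definition left_open_interval :: "('a \<Rightarrow> real) \<Rightarrow> 'a \<Rightarrow> 'a \<Rightarrow> 'a set" where
  "left_open_interval Z x y = {v. prec Z x v \<and> preceq Z v y}"

definition partition_interior :: "('a \<Rightarrow> real) \<Rightarrow> 'a set \<Rightarrow> 'a set" where
  "partition_interior Z A = \<Union> {eq_class Z x | x. eq_class Z x \<subseteq> A}"

definition partition_closure :: "('a \<Rightarrow> real) \<Rightarrow> 'a set \<Rightarrow> 'a set" where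
  "partition_closure Z A = \<Union> {eq_class Z x | x. eq_class Z x \<inter> A \<noteq> {}}"

definition Gamma_lower :: "('a \<Rightarrow> real) \<Rightarrow> 'a set \<Rightarrow> real set" where
  "Gamma_lower Z A = {z \<in> {0..1}. Z -` {z} \<subseteq> A}"

section \<open>P-boxes and their natural extension\<close>

definition cdf_on :: "('a \<Rightarrow> real) \<Rightarrow> 'a \<Rightarrow> ('a \<Rightarrow> real) \<Rightarrow> bool" where
  "cdf_on Z top\<^sub>\<Omega> F \<longleftrightarrow>
     range F \<subseteq> {0..1} \<and> (\<forall>x y. preceq Z x y \<longrightarrow> F x \<le> F y) \<and> F top\<^sub>\<Omega> = 1"

definition p_box :: "('a \<Rightarrow> real) \<Rightarrow> 'a \<Rightarrow> ('a \<Rightarrow> real) \<Rightarrow> ('a \<Rightarrow> real) \<Rightarrow> bool" where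
  "p_box Z top\<^sub>\<Omega> Fl Fu \<longleftrightarrow>
     cdf_on Z top\<^sub>\<Omega> Fl \<and> cdf_on Z top\<^sub>\<Omega> Fu \<and> (\<forall>x. Fl x \<le> Fu x)"

text \<open>A distribution function is constant on the fibres of \<open>Z\<close>, so the choice of the point made
  by \<open>inv Z\<close> does not matter.\<close>

definition as_fun_of_z :: "('a \<Rightarrow> real) \<Rightarrow> ('a \<Rightarrow> real) \<Rightarrow> real \<Rightarrow> real" where
  "as_fun_of_z Z F z = F (inv Z z)"

text \<open>At \<open>z = 0\<close> the filter is trivial, so left-continuity imposes nothing there.\<close>

definition left_continuous_on_unit :: "(real \<Rightarrow> real) \<Rightarrow> bool" where
  "left_continuous_on_unit F \<longleftrightarrow> (\<forall>z\<in>{0..1}. continuous (at z within {0..z}) F)"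

definition matches_p_box ::
  "('a \<Rightarrow> real) \<Rightarrow> 'a \<Rightarrow> 'a \<Rightarrow> ('a \<Rightarrow> real) \<Rightarrow> ('a \<Rightarrow> real) \<Rightarrow> (('a \<Rightarrow> real) \<Rightarrow> real) \<Rightarrow> bool" where
  "matches_p_box Z bot\<^sub>\<Omega> top\<^sub>\<Omega> Fl Fu P \<longleftrightarrow>
     (\<forall>x. on_event P (closed_interval Z bot\<^sub>\<Omega> x) = Fl x) \<and>
     (\<forall>y. on_event P (left_open_interval Z y top\<^sub>\<Omega>) = 1 - Fu y)"

definition is_natural_extension ::
  "('a \<Rightarrow> real) \<Rightarrow> 'a \<Rightarrow> 'a \<Rightarrow> ('a \<Rightarrow> real) \<Rightarrow> ('a \<Rightarrow> real) \<Rightarrow> (('a \<Rightarrow> real) \<Rightarrow> real) \<Rightarrow> bool" where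
  "is_natural_extension Z bot\<^sub>\<Omega> top\<^sub>\<Omega> Fl Fu E \<longleftrightarrow>
     coherent_lower_prevision E \<and> matches_p_box Z bot\<^sub>\<Omega> top\<^sub>\<Omega> Fl Fu E \<and>
     (\<forall>P. coherent_lower_prevision P \<longrightarrow> matches_p_box Z bot\<^sub>\<Omega> top\<^sub>\<Omega> Fl Fu P \<longrightarrow>
        (\<forall>f. gamble f \<longrightarrow> E f \<le> P f))"

lemma natural_extension_unique_on_gambles:
  assumes "is_natural_extension Z b t Fl Fu E" and "is_natural_extension Z b t Fl Fu E'"
    and "gamble f"
  shows "E f = E' f"
  using assms unfolding is_natural_extension_def by (meson antisym)

section \<open>Full components\<close>

definition full :: "real set \<Rightarrow> bool" where
  "full S \<longleftrightarrow> S \<subseteq> {0..1} \<and> (\<forall>a\<in>S. \<forall>b\<in>S. a \<le> b \<longrightarrow> {a..b} \<subseteq> S)"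

definition full_component :: "real set \<Rightarrow> real \<Rightarrow> real set" where
  "full_component T z = (GREATEST S. full S \<and> z \<in> S \<and> S \<subseteq> T)"

definition full_components :: "real set \<Rightarrow> real set set" where
  "full_components T = full_component T ` T"

lemma full_component_greatest:
  assumes "T \<subseteq> {0..1}" and "z \<in> T"
  shows "full (full_component T z)" and "z \<in> full_component T z" and "full_component T z \<subseteq> T"
    and "\<And>S. full S \<Longrightarrow> z \<in> S \<Longrightarrow> S \<subseteq> T \<Longrightarrow> S \<subseteq> full_component T z"
proof -
  define P where "P S \<longleftrightarrow> full S \<and> z \<in> S \<and> S \<subseteq> T" for S
  define U where "U = \<Union> {S. P S}"
  have "c \<in> U" if a: "a \<in> U" and b: "b \<in> U" and c: "a \<le> c" "c \<le> b" for a b c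
  proof -
    obtain S where S: "P S" "a \<in> S" using a by (auto simp: U_def)
    obtain S' where S': "P S'" "b \<in> S'" using b by (auto simp: U_def)
    show ?thesis
    proof (cases "c \<le> z")
      case True
      have "{a..z} \<subseteq> S" using S True c(1) by (simp add: P_def full_def)
      then have "c \<in> S" using True c(1) by auto
      then show ?thesis using S(1) by (auto simp: U_def)
    next
      case False
      have "{z..b} \<subseteq> S'" using S' False c(2) by (simp add: P_def full_def)
      then have "c \<in> S'" using False c(2) by auto
      then show ?thesis using S'(1) by (auto simp: U_def)
    qed
  qed
  then have "\<forall>a\<in>U. \<forall>b\<in>U. a \<le> b \<longrightarrow> {a..b} \<subseteq> U"
    by (meson atLeastAtMost_iff subsetI)
  moreover have "P {z}"
    using assms by (auto simp: P_def full_def)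
  then have "z \<in> U" by (auto simp: U_def)
  moreover have "U \<subseteq> T" by (auto simp: U_def P_def)
  ultimately have "P U"
    using assms(1) by (simp add: P_def full_def)
  moreover have le: "S \<subseteq> U" if "P S" for S using that by (auto simp: U_def)
  ultimately have "Greatest P = U"
    by (intro Greatest_equality)
  then have eq: "full_component T z = U"
    by (simp add: full_component_def P_def[abs_def])
  show "full (full_component T z)" "z \<in> full_component T z" "full_component T z \<subseteq> T"
    using \<open>P U\<close> by (simp_all add: eq P_def)
  show "S \<subseteq> full_component T z" if "full S" "z \<in> S" "S \<subseteq> T" for S
    using le[of S] that by (simp add: eq P_def)
qed

section \<open>Sums of families of non-negative reals\<close>

text \<open>The supremum is taken in \<^typ>\<open>ereal\<close>, so that no default value is assigned to divergent
  sums.\<close>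

definition sum_sup :: "('i \<Rightarrow> real) \<Rightarrow> 'i set \<Rightarrow> ereal" where
  "sum_sup f \<Lambda> = (SUP K\<in>{K. finite K \<and> K \<subseteq> \<Lambda>}. ereal (\<Sum>i\<in>K. f i))"

section \<open>The lower probability of an interval from the distribution functions\<close>

text \<open>\<open>interval_term0\<close> is \<open>max 0 (Fl (Sup I) - Fu (Inf I))\<close> with the convention \<open>Fu(0-) = 0\<close> for
  the lower end of an interval that contains \<open>0\<close>: nothing lies below such an interval, so nothing
  is subtracted. With \<open>Fu (Inf I)\<close> throughout, the term for \<open>I = {0..1}\<close> would be \<open>1 - Fu 0\<close>,
  whereas the lower probability of the whole space is \<open>1\<close>.\<close>

definition interval_term0 :: "(real \<Rightarrow> real) \<Rightarrow> (real \<Rightarrow> real) \<Rightarrow> real set \<Rightarrow> real" where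
  "interval_term0 Fl Fu I = max 0 (Fl (Sup I) - (if 0 \<in> I then 0 else Fu (Inf I)))"

end

theory Submission imports Defs begin

text \<open>The natural extension is bounded from both sides by the sum over the full components of
  \<open>\<Gamma>\<^sub>*(A)\<close>.

  From below, \<open>A\<close> contains the pairwise disjoint preimages of its components, and a coherent lower
  prevision is superadditive (\<open>sum_disjoint_events_le\<close>).

  From above, minimality of the natural extension makes every coherent lower prevision that
  matches the p-box an upper bound, so one well-chosen such prevision is enough. Pick a level \<open>t\<close>
  uniformly in \<open>(0, 1)\<close>. At this level the p-box says of a random point that it is at
  most \<open>x\<close> if \<open>t < Fl x\<close> and that it exceeds \<open>y\<close> if \<open>Fu y < t\<close>, so that it lies in every cell
  \<open>(y, x]\<close> with \<open>Fu y < t < Fl x\<close>; beyond that it says nothing. These cells form a filter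
  base; the limit of the infima of a gamble along it is a coherent lower prevision, and so is the
  average of these limits over \<open>t\<close>. The average matches the p-box, and it gives \<open>A\<close> the Lebesgue
  measure of the set of levels \<open>t\<close> for which some focal cell lies in \<open>A\<close>
  (\<open>natural_extension_le\<close>). A nonempty cell inside \<open>A\<close> is an interval and hence lies in the preimage
  of a single component, so the levels of \<open>A\<close> are covered by the levels of its components. The
  levels of one component form a set whose diameter is at most the lower probability of that
  component (\<open>measure_levels_full_le\<close>). All these sets are open, so by Lindelof's theorem a countable
  subfamily covers, and countable subadditivity of the measure finishes the argument, however many
  components there are.

  Excluding the two extreme levels of a cell is what makes these sets open; it costs nothing, since
  single levels have measure zero. Left-continuity of \<open>Fl\<close> enters in the evaluation of a single
  interval: cells inside \<open>I\<close> reach up to points of \<open>I\<close>, and left-continuity lets their upper ends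
  pass to \<open>Sup I\<close> (\<open>event_full_eq\<close>). The formulas for the conjugate follow from those for the
  complement.\<close>

section \<open>Coherent lower previsions\<close>

lemma gamble_bound:
  assumes "gamble f"
  obtains c where "\<And>x. \<bar>f x\<bar> \<le> c"
  using assms unfolding gamble_def bounded_iff by auto

lemma gambleI: "(\<And>x. \<bar>f x\<bar> \<le> c) \<Longrightarrow> gamble f"
  unfolding gamble_def bounded_iff by auto

lemma gamble_indicator: "gamble (indicator A)"
  by (rule gambleI[of _ 1]) (simp add: indicator_def)

lemma gamble_const: "gamble (\<lambda>x. c)"
  by (rule gambleI[of _ "\<bar>c\<bar>"]) simp

lemma gamble_add:
  assumes "gamble f" "gamble g" shows "gamble (\<lambda>x. f x + g x)"
proof -
  obtain c d where "\<And>x. \<bar>f x\<bar> \<le> c" "\<And>x. \<bar>g x\<bar> \<le> d"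
    using assms by (metis gamble_bound)
  then have "\<bar>f x + g x\<bar> \<le> c + d" for x
    by (meson abs_triangle_ineq add_mono order_trans)
  then show ?thesis by (rule gambleI)
qed

lemma gamble_scale:
  assumes "gamble f" shows "gamble (\<lambda>x. c * f x)"
proof -
  obtain d where "\<And>x. \<bar>f x\<bar> \<le> d" using assms by (rule gamble_bound) auto
  then have "\<bar>c * f x\<bar> \<le> \<bar>c\<bar> * d" for x
    by (simp add: abs_mult mult_left_mono)
  then show ?thesis by (rule gambleI)
qed

lemma gamble_diff:
  assumes "gamble f" "gamble g" shows "gamble (\<lambda>x. f x - g x)"
  using gamble_add[OF assms(1) gamble_scale[OF assms(2), of "-1"]] by simp

lemma gamble_sum:
  assumes "\<And>i. i \<in> K \<Longrightarrow> gamble (f i)"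
  shows "gamble (\<lambda>x. \<Sum>i\<in>K. f i x)"
  using assms
proof (induction K rule: infinite_finite_induct)
  case (insert i K)
  then show ?case using gamble_add[of "f i" "\<lambda>x. \<Sum>i\<in>K. f i x"] by simp
qed (simp_all add: gamble_const)

lemma gamble_bdd_below: "gamble f \<Longrightarrow> bdd_below (f ` S)"
  by (meson bdd_below_mono bounded_imp_bdd_below gamble_def image_mono subset_UNIV)

context
  fixes P :: "('a \<Rightarrow> real) \<Rightarrow> real"
  assumes P: "coherent_lower_prevision P"
begin

lemma coherent_ge: "gamble f \<Longrightarrow> (\<And>x. c \<le> f x) \<Longrightarrow> c \<le> P f"
  using P unfolding coherent_lower_prevision_def
  by (meson UNIV_not_empty cINF_greatest order_trans)

lemma coherent_scale: "gamble f \<Longrightarrow> c \<ge> 0 \<Longrightarrow> P (\<lambda>x. c * f x) = c * P f"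
  using P unfolding coherent_lower_prevision_def by blast

lemma coherent_add: "gamble f \<Longrightarrow> gamble g \<Longrightarrow> P f + P g \<le> P (\<lambda>x. f x + g x)"
  using P unfolding coherent_lower_prevision_def by blast

lemma coherent_mono:
  assumes "gamble f" "gamble g" "\<And>x. f x \<le> g x"
  shows "P f \<le> P g"
proof -
  have "0 \<le> P (\<lambda>x. g x - f x)"
    using assms by (intro coherent_ge gamble_diff) auto
  moreover have "P f + P (\<lambda>x. g x - f x) \<le> P (\<lambda>x. f x + (g x - f x))"
    using assms by (intro coherent_add gamble_diff)
  ultimately show ?thesis by simp
qed

text \<open>Superadditivity against the constants \<open>c\<close> and \<open>- c\<close> squeezes the value from both sides.\<close>

lemma coherent_const_add:
  assumes "gamble f"
  shows "P (\<lambda>x. c + f x) = c + P f"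
proof (rule antisym)
  have 1: "c \<le> P (\<lambda>x. c)" "- c \<le> P (\<lambda>x. - c)"
    by (auto intro!: coherent_ge gamble_const)
  show "c + P f \<le> P (\<lambda>x. c + f x)"
    using coherent_add[OF gamble_const assms, of c] 1 by simp
  show "P (\<lambda>x. c + f x) \<le> c + P f"
    using coherent_add[OF gamble_const gamble_add[OF gamble_const assms], of "-c" c] 1 by simp
qed

lemma coherent_zero: "P (\<lambda>x. 0) = 0"
  using coherent_scale[OF gamble_const[of 0], of 0] by simp

lemma coherent_le:
  assumes "gamble f" "\<And>x. f x \<le> c"
  shows "P f \<le> c"
  using coherent_mono[OF assms(1) gamble_const, of c] coherent_const_add[OF gamble_const, of c 0]
    coherent_zero assms(2) by simp

lemma coherent_sum:
  assumes "\<And>i. i \<in> K \<Longrightarrow> gamble (f i)"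
  shows "(\<Sum>i\<in>K. P (f i)) \<le> P (\<lambda>x. \<Sum>i\<in>K. f i x)"
  using assms
proof (induction K rule: infinite_finite_induct)
  case (insert i K)
  have "(\<Sum>i\<in>insert i K. P (f i)) \<le> P (f i) + P (\<lambda>x. \<Sum>i\<in>K. f i x)"
    using insert by simp
  also have "\<dots> \<le> P (\<lambda>x. f i x + (\<Sum>i\<in>K. f i x))"
    using insert by (intro coherent_add gamble_sum) auto
  finally show ?case using insert by simp
qed (simp_all add: coherent_zero)

lemma event_mono: "A \<subseteq> B \<Longrightarrow> on_event P A \<le> on_event P B"
  unfolding on_event_def by (intro coherent_mono gamble_indicator) (auto simp: indicator_def)

lemma event_nonneg: "0 \<le> on_event P A"
  unfolding on_event_def by (intro coherent_ge gamble_indicator) simp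

lemma sum_disjoint_events_le:
  assumes "finite K" "disjoint_family_on f K" "\<And>i. i \<in> K \<Longrightarrow> f i \<subseteq> A"
  shows "(\<Sum>i\<in>K. on_event P (f i)) \<le> on_event P A"
proof -
  have "(\<Sum>i\<in>K. on_event P (f i)) \<le> P (\<lambda>x. \<Sum>i\<in>K. indicator (f i) x)"
    unfolding on_event_def by (intro coherent_sum gamble_indicator)
  also have "(\<lambda>x. \<Sum>i\<in>K. indicator (f i) x) = (indicator (\<Union>i\<in>K. f i) :: 'a \<Rightarrow> real)"
    using assms(1,2) by (simp add: indicator_UN_disjoint fun_eq_iff)
  also have "P \<dots> \<le> on_event P A"
    using event_mono[of "\<Union>i\<in>K. f i" A] assms(3) unfolding on_event_def by blast
  finally show ?thesis .
qed

lemma conjugate_event: "on_event (conjugate P) A = 1 - on_event P (- A)"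
proof -
  have "(\<lambda>x. - indicator A x) = (\<lambda>x. -1 + indicator (- A) x :: real)"
    by (auto simp: indicator_def)
  then show ?thesis
    using coherent_const_add[OF gamble_indicator, of "-1" "- A"]
    unfolding on_event_def conjugate_def by simp
qed

text \<open>Where \<open>A\<close> and \<open>B\<close> cover the space, their indicators add up to \<open>1\<close> plus the indicator of
  \<open>A \<inter> B\<close>. Applied to an initial and a final segment, this turns the two prescribed families of
  values into bounds for the intervals in between.\<close>

lemma event_Int_ge:
  assumes "A \<union> B = UNIV"
  shows "on_event P A + on_event P B - 1 \<le> on_event P (A \<inter> B)"
proof -
  have "(\<lambda>x. indicator A x + indicator B x) = (\<lambda>x. 1 + indicator (A \<inter> B) x :: real)"
    using assms by (auto simp: indicator_def fun_eq_iff)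
  then show ?thesis
    using coherent_add[OF gamble_indicator[of A] gamble_indicator[of B]]
    unfolding on_event_def by (simp add: coherent_const_add gamble_indicator)
qed

end

section \<open>Two constructions of coherent lower previsions\<close>

definition filter_base :: "'a set set \<Rightarrow> bool" where
  "filter_base B \<longleftrightarrow> B \<noteq> {} \<and> {} \<notin> B \<and> (\<forall>S\<in>B. \<forall>T\<in>B. S \<inter> T \<in> B)"

definition lower_limit_along :: "'a set set \<Rightarrow> ('a \<Rightarrow> real) \<Rightarrow> real" where
  "lower_limit_along B f = (SUP S\<in>B. INF v\<in>S. f v)"

lemma bdd_above_INF_gamble:
  assumes "gamble f" "{} \<notin> B"
  shows "bdd_above ((\<lambda>S. INF v\<in>S. f v) ` B)"
proof -
  obtain c where c: "\<And>x. \<bar>f x\<bar> \<le> c" using assms(1) by (rule gamble_bound) auto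
  have "(INF v\<in>S. f v) \<le> c" if "S \<in> B" for S
  proof -
    have "S \<noteq> {}" using that assms(2) by auto
    then obtain v where "v \<in> S" by auto
    then show ?thesis using c[of v] gamble_bdd_below[OF assms(1), of S]
      by (intro cINF_lower2) auto
  qed
  then show ?thesis by (auto simp: bdd_above_def)
qed

lemma lower_limit_along_ge:
  assumes "gamble f" "filter_base B" "S \<in> B" "\<And>v. v \<in> S \<Longrightarrow> c \<le> f v"
  shows "c \<le> lower_limit_along B f"
proof -
  have "c \<le> (INF v\<in>S. f v)"
    using assms by (intro cINF_greatest) (auto simp: filter_base_def)
  then show ?thesis unfolding lower_limit_along_def
    using assms by (intro cSUP_upper2[where x=S] bdd_above_INF_gamble) (auto simp: filter_base_def)
qed

lemma lower_limit_along_le: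
  assumes "filter_base B" "\<And>S. S \<in> B \<Longrightarrow> (INF v\<in>S. f v) \<le> c"
  shows "lower_limit_along B f \<le> c"
  unfolding lower_limit_along_def using assms by (intro cSUP_least) (auto simp: filter_base_def)

text \<open>This is the pointwise supremum of the vacuous previsions of the members of \<open>B\<close>. A supremum
  of previsions need not be superadditive; here it is, by closure under intersections:
  lower bounds of \<open>f\<close> on \<open>S\<close> and of \<open>g\<close> on \<open>T\<close> add up on \<open>S \<inter> T\<close>.\<close>

lemma coherent_lower_limit_along:
  assumes B: "filter_base B"
  shows "coherent_lower_prevision (lower_limit_along B)"
proof -
  obtain S0 where S0: "S0 \<in> B" using B by (auto simp: filter_base_def)
  have low: "(INF x. f x) \<le> lower_limit_along B f" if "gamble f" for f
    using that by (intro lower_limit_along_ge[OF _ B S0] cINF_lower gamble_bdd_below) auto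
  \<comment> \<open>One inequality for all \<open>c > 0\<close> suffices: the other one is its instance for \<open>inverse c\<close>.\<close>
  have scale: "c * lower_limit_along B f \<le> lower_limit_along B (\<lambda>x. c * f x)"
    if f: "gamble f" and c: "c > 0" for f and c :: real
  proof -
    have "lower_limit_along B f \<le> lower_limit_along B (\<lambda>x. c * f x) / c"
    proof (rule lower_limit_along_le[OF B])
      fix S assume S: "S \<in> B"
      have "c * (INF v\<in>S. f v) \<le> lower_limit_along B (\<lambda>x. c * f x)"
        using c by (intro lower_limit_along_ge[OF gamble_scale[OF f] B S])
          (auto intro!: mult_left_mono cINF_lower gamble_bdd_below f)
      then show "(INF v\<in>S. f v) \<le> lower_limit_along B (\<lambda>x. c * f x) / c"
        using c by (simp add: field_simps)
    qed
    then show ?thesis using c by (simp add: field_simps)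
  qed
  have "lower_limit_along B (\<lambda>x. c * f x) = c * lower_limit_along B f"
    if f: "gamble f" and c: "c \<ge> 0" for f c
  proof (cases "c = 0")
    case True
    have "lower_limit_along B (\<lambda>x. 0) = 0"
    proof (rule antisym)
      show "lower_limit_along B (\<lambda>x. 0) \<le> 0"
        using B by (intro lower_limit_along_le) (metis cINF_const filter_base_def order_refl)+
      show "0 \<le> lower_limit_along B (\<lambda>x. 0)"
        using lower_limit_along_ge[OF gamble_const B S0] by simp
    qed
    then show ?thesis using True by simp
  next
    case False
    then have c: "c > 0" using c by simp
    have "inverse c * lower_limit_along B (\<lambda>x. c * f x) \<le> lower_limit_along B f"
      using scale[OF gamble_scale[OF f, of c], of "inverse c"] c
      by (simp add: mult.assoc[symmetric])
    then show ?thesis using scale[OF f c] c by (simp add: field_simps)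
  qed
  moreover have "lower_limit_along B f + lower_limit_along B g
      \<le> lower_limit_along B (\<lambda>x. f x + g x)" if f: "gamble f" and g: "gamble g" for f g
  proof -
    have 1: "(INF v\<in>S. f v) + (INF v\<in>T. g v) \<le> lower_limit_along B (\<lambda>x. f x + g x)"
      if "S \<in> B" "T \<in> B" for S T
    proof (rule lower_limit_along_ge[OF gamble_add[OF f g] B])
      show "S \<inter> T \<in> B" using that B by (auto simp: filter_base_def)
    qed (auto intro!: add_mono cINF_lower gamble_bdd_below f g)
    have "lower_limit_along B f \<le> lower_limit_along B (\<lambda>x. f x + g x) - (INF v\<in>T. g v)"
      if "T \<in> B" for T
      using 1[OF _ that] by (intro lower_limit_along_le[OF B]) (simp add: algebra_simps)
    then have "lower_limit_along B g \<le> lower_limit_along B (\<lambda>x. f x + g x) - lower_limit_along B f"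
      by (intro lower_limit_along_le[OF B]) (simp add: algebra_simps)
    then show ?thesis by simp
  qed
  ultimately show ?thesis
    unfolding coherent_lower_prevision_def using low by blast
qed

text \<open>Superlevel sets in \<open>t\<close> are the way to measurability when \<open>B\<close> varies with a parameter
  \<open>t\<close>.\<close>

lemma lower_limit_along_gt_iff:
  assumes "gamble f" "filter_base B"
  shows "c < lower_limit_along B f \<longleftrightarrow> (\<exists>S\<in>B. c < (INF v\<in>S. f v))"
  unfolding lower_limit_along_def using assms
  by (intro less_cSUP_iff bdd_above_INF_gamble) (auto simp: filter_base_def)

lemma lower_limit_along_indicator:
  assumes B: "filter_base B"
  shows "lower_limit_along B (indicator A) = (if \<exists>S\<in>B. S \<subseteq> A then 1 else 0)"
proof (cases "\<exists>S\<in>B. S \<subseteq> A")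
  case True
  then obtain S where S: "S \<in> B" "S \<subseteq> A" by auto
  have "1 \<le> lower_limit_along B (indicator A)"
    using S by (intro lower_limit_along_ge[OF gamble_indicator B S(1)]) auto
  moreover have "lower_limit_along B (indicator A) \<le> 1"
    by (rule coherent_le[OF coherent_lower_limit_along[OF B] gamble_indicator])
      (simp add: indicator_def)
  ultimately show ?thesis using True by simp
next
  case False
  have "lower_limit_along B (indicator A) \<le> 0"
  proof (rule lower_limit_along_le[OF B])
    fix S assume "S \<in> B"
    then obtain v where "v \<in> S" "v \<notin> A" using False by auto
    then show "(INF v\<in>S. indicator A v) \<le> (0::real)"
      by (intro cINF_lower2[where x=v] gamble_bdd_below gamble_indicator) auto
  qed
  moreover have "0 \<le> lower_limit_along B (indicator A)"
    by (rule coherent_ge[OF coherent_lower_limit_along[OF B] gamble_indicator]) simp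
  ultimately show ?thesis using False by auto
qed

text \<open>Each coherence axiom is a linear inequality between values of the prevision, and integration
  is monotone and linear. Coherence also supplies the uniform bound that makes \<open>\<lambda>t. Q t f\<close>
  integrable.\<close>

lemma coherent_mixture:
  assumes M: "finite_measure M" "measure M (space M) = 1"
    and Q: "\<And>t. t \<in> space M \<Longrightarrow> coherent_lower_prevision (Q t)"
    and meas: "\<And>f. gamble f \<Longrightarrow> (\<lambda>t. Q t f) \<in> borel_measurable M"
  shows "coherent_lower_prevision (\<lambda>f. \<integral>t. Q t f \<partial>M)"
proof -
  interpret finite_measure M by (rule M)
  have int: "integrable M (\<lambda>t. Q t f)" if f: "gamble f" for f
  proof -
    obtain c where c: "\<And>x. \<bar>f x\<bar> \<le> c" using f by (rule gamble_bound) auto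
    have "norm (Q t f) \<le> c" if "t \<in> space M" for t
      using coherent_le[OF Q[OF that] f, of c] coherent_ge[OF Q[OF that] f, of "-c"] c
      by (simp add: abs_le_iff minus_le_iff)
    then show ?thesis
      by (intro integrable_const_bound[of _ c] AE_I2 meas f)
  qed
  have "(INF x. f x) \<le> (\<integral>t. Q t f \<partial>M)" if f: "gamble f" for f
  proof -
    have "(INF x. f x) = (\<integral>t. (INF x. f x) \<partial>M)" using M by simp
    also have "\<dots> \<le> (\<integral>t. Q t f \<partial>M)"
      using Q f unfolding coherent_lower_prevision_def by (intro integral_mono int) auto
    finally show ?thesis .
  qed
  moreover have "(\<integral>t. Q t (\<lambda>x. c * f x) \<partial>M) = c * (\<integral>t. Q t f \<partial>M)"
    if "gamble f" "c \<ge> 0" for f c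
  proof -
    have "(\<integral>t. Q t (\<lambda>x. c * f x) \<partial>M) = (\<integral>t. c * Q t f \<partial>M)"
      using that by (intro Bochner_Integration.integral_cong refl coherent_scale[OF Q])
    then show ?thesis by simp
  qed
  moreover have "(\<integral>t. Q t f \<partial>M) + (\<integral>t. Q t g \<partial>M) \<le> (\<integral>t. Q t (\<lambda>x. f x + g x) \<partial>M)"
    if "gamble f" "gamble g" for f g
  proof -
    have "(\<integral>t. Q t f \<partial>M) + (\<integral>t. Q t g \<partial>M) = (\<integral>t. Q t f + Q t g \<partial>M)"
      using that by (simp add: int)
    also have "\<dots> \<le> (\<integral>t. Q t (\<lambda>x. f x + g x) \<partial>M)"
      using that by (intro integral_mono Bochner_Integration.integrable_add int gamble_add
          coherent_add[OF Q])
    finally show ?thesis .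
  qed
  ultimately show ?thesis unfolding coherent_lower_prevision_def by blast
qed

section \<open>Suprema of sums, full components and diameters\<close>

text \<open>The second premise asks for real bounds only; if there were none, the supremum would be
  \<open>\<infinity>\<close>, but then the first premise would fail.\<close>

lemma sum_sup_eqI:
  assumes "\<And>K. finite K \<Longrightarrow> K \<subseteq> \<Lambda> \<Longrightarrow> (\<Sum>i\<in>K. f i) \<le> r"
    and "\<And>b. (\<And>K. finite K \<Longrightarrow> K \<subseteq> \<Lambda> \<Longrightarrow> (\<Sum>i\<in>K. f i) \<le> b) \<Longrightarrow> r \<le> b"
  shows "sum_sup f \<Lambda> = ereal r"
proof (rule antisym)
  show "sum_sup f \<Lambda> \<le> ereal r"
    unfolding sum_sup_def using assms(1) by (intro SUP_least) auto
  have le: "ereal (\<Sum>i\<in>K. f i) \<le> sum_sup f \<Lambda>" if "finite K" "K \<subseteq> \<Lambda>" for K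
    unfolding sum_sup_def using that by (intro SUP_upper) auto
  show "ereal r \<le> sum_sup f \<Lambda>"
  proof (cases "sum_sup f \<Lambda>")
    case (real b)
    then show ?thesis using le assms(2)[of b] by simp
  next
    case MInf
    then show ?thesis using le[of "{}"] by simp
  qed simp
qed

lemma sum_sup_cong: "(\<And>i. i \<in> \<Lambda> \<Longrightarrow> f i = g i) \<Longrightarrow> sum_sup f \<Lambda> = sum_sup g \<Lambda>"
  unfolding sum_sup_def by (intro SUP_cong refl) (auto intro!: arg_cong[of _ _ ereal] sum.cong)

lemma full_union:
  assumes "full S" "full T" "z \<in> S" "z \<in> T"
  shows "full (S \<union> T)"
  unfolding full_def
proof (intro conjI ballI impI subsetI)
  show "x \<in> {0..1}" if "x \<in> S \<union> T" for x
    using assms that by (auto simp: full_def)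
  fix a b c assume ab: "a \<in> S \<union> T" "b \<in> S \<union> T" "a \<le> b" and c: "c \<in> {a..b}"
  have *: "c \<in> R" if "full R" "u \<in> R" "v \<in> R" "u \<le> c" "c \<le> v" for R u v
    using that unfolding full_def by (meson atLeastAtMost_iff order_trans subsetD)
  show "c \<in> S \<union> T"
    using * assms ab c by (cases "c \<le> z") (auto intro: *)
qed

text \<open>Two full components with a common point have a full union, which by maximality is contained
  in each of them.\<close>

lemma full_components_disjoint:
  assumes T: "T \<subseteq> {0..1}" and I: "I \<in> full_components T" and J: "J \<in> full_components T"
    and z: "z \<in> I" "z \<in> J"
  shows "I = J"
proof -
  have "I' \<subseteq> J'" if IJ: "I' \<in> full_components T" "J' \<in> full_components T"
    and zz: "z \<in> I'" "z \<in> J'" for I' J'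
  proof -
    obtain i j where i: "i \<in> T" "I' = full_component T i" and j: "j \<in> T" "J' = full_component T j"
      using IJ unfolding full_components_def by blast
    have "full (J' \<union> I')"
      using zz full_component_greatest(1)[OF T i(1)] full_component_greatest(1)[OF T j(1)] i j
      by (intro full_union[of _ _ z]) auto
    then have "J' \<union> I' \<subseteq> J'"
      using full_component_greatest(2,3)[OF T j(1)] full_component_greatest(3)[OF T i(1)]
        full_component_greatest(4)[OF T j(1), of "J' \<union> I'"] i(2) j(2) by auto
    then show ?thesis by blast
  qed
  then show ?thesis using assms by blast
qed

text \<open>A bounded set of reals lies in an interval whose length is its diameter.\<close>

lemma measure_le_diameter:
  fixes T :: "real set"
  assumes "T \<in> sets lborel" "0 \<le> d" and d: "\<And>s t. s \<in> T \<Longrightarrow> t \<in> T \<Longrightarrow> s - t \<le> d"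
  shows "measure lborel T \<le> d"
proof (cases "T = {}")
  case False
  then obtain t where t: "t \<in> T" by auto
  have "s \<le> t + d" "t - d \<le> s" if "s \<in> T" for s
    using d[OF that t] d[OF t that] by auto
  then have bdd: "bdd_above T" "bdd_below T" by (auto simp: bdd_above_def bdd_below_def)
  have "Sup T \<le> d + s" if "s \<in> T" for s
    using that d[of _ s] False by (intro cSup_least) (auto simp: algebra_simps)
  then have le: "Sup T - d \<le> Inf T"
    using False by (intro cInf_greatest) (auto simp: algebra_simps)
  have sub: "T \<subseteq> {Inf T..Sup T}"
    using bdd by (auto intro: cInf_lower cSup_upper)
  then have "measure lborel T \<le> measure lborel {Inf T..Sup T}"
    using assms by (intro measure_mono_fmeasurable fmeasurable_compact) auto
  also have "\<dots> \<le> d"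
    using sub t le by (subst measure_lborel_Icc) auto
  finally show ?thesis .
qed (use assms in simp)

section \<open>The natural extension as a mixture over focal intervals\<close>

locale p_box_extension =
  fixes Z :: "'a \<Rightarrow> real" and bot\<^sub>\<Omega> top\<^sub>\<Omega> :: 'a
    and Fl Fu :: "'a \<Rightarrow> real" and E :: "('a \<Rightarrow> real) \<Rightarrow> real"
  assumes Z_range: "range Z = {0..1}" and Z_bot: "Z bot\<^sub>\<Omega> = 0" and Z_top: "Z top\<^sub>\<Omega> = 1"
    and p_box: "p_box Z top\<^sub>\<Omega> Fl Fu"
    and nat_ext: "is_natural_extension Z bot\<^sub>\<Omega> top\<^sub>\<Omega> Fl Fu E"
begin

text \<open>The two distribution functions as functions on the real line. Putting \<open>U\<close> to \<open>0\<close> on the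
  negative numbers lets cells with a negative lower end play the role of the initial segments
  \<open>[0, x]\<close>, so that these need no case of their own. Above \<open>1\<close>, and for \<open>G\<close> outside \<open>[0, 1]\<close>, the
  values are arbitrary; hence the bounds on \<open>x\<close> and \<open>y\<close> below.\<close>

abbreviation G :: "real \<Rightarrow> real" where "G \<equiv> as_fun_of_z Z Fl"

definition U :: "real \<Rightarrow> real" where
  "U y = (if y < 0 then 0 else as_fun_of_z Z Fu y)"

definition cell :: "real \<Rightarrow> real \<Rightarrow> 'a set" where
  "cell y x = {v. y < Z v \<and> Z v \<le> x}"

text \<open>The intervals to which the p-box confines a random point of level \<open>t\<close>.\<close>

definition focal :: "real \<Rightarrow> 'a set set" where
  "focal t = {cell y x | y x. y \<in> {-1..1} \<and> x \<in> {0..1} \<and> U y < t \<and> t < G x}"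

text \<open>The levels \<open>t\<close> with a focal cell inside \<open>A\<close> (\<open>levels_iff\<close>), written as a union of open
  intervals.\<close>

definition levels :: "'a set \<Rightarrow> real set" where
  "levels A = \<Union> {{U y<..<G x} | y x. y \<in> {-1..1} \<and> x \<in> {0..1} \<and> cell y x \<subseteq> A}"

definition focal_mixture :: "('a \<Rightarrow> real) \<Rightarrow> real" where
  "focal_mixture f = (\<integral>t. lower_limit_along (focal t) f \<partial>restrict_space lborel {0<..<1})"

lemma Z_unit: "0 \<le> Z v" "Z v \<le> 1"
  using Z_range by (auto simp: set_eq_iff image_iff)

lemma Z_surj: "z \<in> {0..1} \<Longrightarrow> \<exists>v. Z v = z"
  using Z_range by (metis imageE)

lemma E_coherent: "coherent_lower_prevision E"
  using nat_ext by (simp add: is_natural_extension_def)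

lemma cdf_mono: "cdf_on Z top\<^sub>\<Omega> F \<Longrightarrow> Z v \<le> Z w \<Longrightarrow> F v \<le> F w"
  by (auto simp: cdf_on_def preceq_def)

lemma as_fun_of_z_apply:
  assumes "cdf_on Z top\<^sub>\<Omega> F" shows "as_fun_of_z Z F (Z v) = F v"
proof -
  have "Z (inv Z (Z v)) = Z v" by (simp add: f_inv_into_f)
  then show ?thesis unfolding as_fun_of_z_def using assms by (metis antisym cdf_mono order_refl)
qed

lemma cdfs: "cdf_on Z top\<^sub>\<Omega> Fl" "cdf_on Z top\<^sub>\<Omega> Fu" "Fl v \<le> Fu v"
  using p_box by (auto simp: p_box_def)

lemma G_Z [simp]: "G (Z v) = Fl v"
  by (rule as_fun_of_z_apply) (rule cdfs)

lemma U_Z [simp]: "U (Z v) = Fu v"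
  using Z_unit[of v] by (simp add: U_def as_fun_of_z_apply cdfs)

lemma G_bounds: "x \<in> {0..1} \<Longrightarrow> 0 \<le> G x \<and> G x \<le> 1"
  using cdfs(1) by (auto simp: cdf_on_def as_fun_of_z_def image_subset_iff)

lemma U_bounds: "0 \<le> U y \<and> U y \<le> 1"
  using cdfs(2) by (auto simp: cdf_on_def as_fun_of_z_def U_def image_subset_iff)

lemma U_neg [simp]: "y < 0 \<Longrightarrow> U y = 0" by (simp add: U_def)

lemma G_one [simp]: "G 1 = 1"
  using G_Z[of top\<^sub>\<Omega>] cdfs(1) by (simp add: Z_top cdf_on_def)

lemma G_mono: "x \<in> {0..1} \<Longrightarrow> x' \<in> {0..1} \<Longrightarrow> x \<le> x' \<Longrightarrow> G x \<le> G x'"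
  using Z_surj[of x] Z_surj[of x'] cdf_mono[OF cdfs(1)] by auto

lemma U_mono:
  assumes "y' \<le> 1" "y \<le> y'" shows "U y \<le> U y'"
proof (cases "y < 0")
  case True
  then show ?thesis using U_bounds[of y'] by simp
next
  case False
  then obtain v v' where v: "Z v = y" "Z v' = y'" using assms Z_surj[of y] Z_surj[of y'] by auto
  then have "Fu v \<le> Fu v'" using assms by (intro cdf_mono[OF cdfs(2)]) simp
  then show ?thesis using U_Z[of v] U_Z[of v'] v by simp
qed

lemma G_le_U:
  assumes "x \<in> {0..1}" "y \<le> 1" "x \<le> y" shows "G x \<le> U y"
proof -
  obtain v where v: "Z v = x" using assms(1) Z_surj by blast
  have "G x \<le> U x" using cdfs(3)[of v] U_Z[of v] G_Z[of v] v by simp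
  also have "\<dots> \<le> U y" using assms by (intro U_mono)
  finally show ?thesis .
qed

lemma less_if_level: "x \<in> {0..1} \<Longrightarrow> y \<le> 1 \<Longrightarrow> U y < t \<Longrightarrow> t < G x \<Longrightarrow> y < x"
  using G_le_U[of x y] by force

lemma cell_Int: "cell y x \<inter> cell y' x' = cell (max y y') (min x x')"
  by (auto simp: cell_def)

lemma cell_nonempty: "x \<in> {0..1} \<Longrightarrow> y < x \<Longrightarrow> cell y x \<noteq> {}"
  using Z_surj[of x] by (force simp: cell_def)

lemma focalI: "y \<in> {-1..1} \<Longrightarrow> x \<in> {0..1} \<Longrightarrow> U y < t \<Longrightarrow> t < G x \<Longrightarrow> cell y x \<in> focal t"
  unfolding focal_def by blast

lemma levelsI: "y \<in> {-1..1} \<Longrightarrow> x \<in> {0..1} \<Longrightarrow> cell y x \<subseteq> A \<Longrightarrow> U y < t \<Longrightarrow> t < G x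
    \<Longrightarrow> t \<in> levels A"
  unfolding levels_def by force

lemma levelsE:
  assumes "t \<in> levels A"
  obtains y x where "y \<in> {-1..1}" "x \<in> {0..1}" "cell y x \<subseteq> A" "U y < t" "t < G x" "y < x"
proof -
  obtain y x where *: "y \<in> {-1..1}" "x \<in> {0..1}" "cell y x \<subseteq> A" "U y < t" "t < G x"
    using assms unfolding levels_def by force
  moreover have "y < x" using less_if_level[OF *(2) _ *(4,5)] *(1) by auto
  ultimately show ?thesis by (rule that)
qed

lemma filter_base_focal:
  assumes t: "t \<in> {0<..<1}"
  shows "filter_base (focal t)"
  unfolding filter_base_def
proof (intro conjI ballI)
  have "cell (-1) 1 \<in> focal t"
    using t by (intro focalI) auto
  then show "focal t \<noteq> {}" by auto
  show "{} \<notin> focal t"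
  proof
    assume "{} \<in> focal t"
    then obtain y x where *: "{} = cell y x" "y \<in> {-1..1}" "x \<in> {0..1}" "U y < t" "t < G x"
      unfolding focal_def by blast
    then show False using cell_nonempty[OF *(3) less_if_level[OF *(3) _ *(4,5)]] by simp
  qed
  fix S T assume "S \<in> focal t" "T \<in> focal t"
  then obtain y x y' x' where *:
    "S = cell y x" "y \<in> {-1..1}" "x \<in> {0..1}" "U y < t" "t < G x"
    "T = cell y' x'" "y' \<in> {-1..1}" "x' \<in> {0..1}" "U y' < t" "t < G x'"
    unfolding focal_def by blast
  then have "U (max y y') < t" "t < G (min x x')" by (auto simp: max_def min_def)
  with * show "S \<inter> T \<in> focal t"
    by (auto simp: cell_Int intro!: focalI)
qed

lemma levels_iff: "t \<in> levels A \<longleftrightarrow> (\<exists>S\<in>focal t. S \<subseteq> A)"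
proof
  assume "t \<in> levels A"
  then obtain y x where "y \<in> {-1..1}" "x \<in> {0..1}" "cell y x \<subseteq> A" "U y < t" "t < G x"
    by (rule levelsE)
  then show "\<exists>S\<in>focal t. S \<subseteq> A" by (intro bexI[of _ "cell y x"] focalI)
next
  assume "\<exists>S\<in>focal t. S \<subseteq> A"
  then obtain y x where "y \<in> {-1..1}" "x \<in> {0..1}" "cell y x \<subseteq> A" "U y < t" "t < G x"
    unfolding focal_def by blast
  then show "t \<in> levels A" by (rule levelsI)
qed

lemma open_levels: "open (levels A)"
  unfolding levels_def by (intro open_Union) auto

lemma levels_subset: "levels A \<subseteq> {0<..<1}"
proof
  fix t assume "t \<in> levels A"
  then obtain y x where "x \<in> {0..1}" "U y < t" "t < G x" by (rule levelsE)
  then show "t \<in> {0<..<1}" using U_bounds[of y] G_bounds[of x] by auto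
qed

lemma levels_fmeasurable: "levels A \<in> fmeasurable lborel"
  by (rule fmeasurableI2[of "{0..1}"])
    (use levels_subset[of A] open_levels[of A] in \<open>auto intro!: fmeasurable_compact\<close>)

text \<open>Measurability of the integrand is the only point to settle: its superlevel sets are unions of
  open intervals \<open>(U y, G x)\<close>, hence open however many cells contribute.\<close>

lemma coherent_focal_mixture: "coherent_lower_prevision focal_mixture"
proof -
  let ?M = "restrict_space lborel {0<..<1::real}"
  have "emeasure ?M (space ?M) = 1"
    by (simp add: emeasure_restrict_space space_restrict_space)
  then have "finite_measure ?M" "measure ?M (space ?M) = 1"
    by (auto intro!: finite_measureI simp: measure_def)
  moreover have "(\<lambda>t. lower_limit_along (focal t) f) \<in> borel_measurable ?M" if f: "gamble f" for f
    unfolding borel_measurable_iff_greater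
  proof
    fix c
    let ?W = "\<Union> {{U y<..<G x} | y x.
      y \<in> {-1..1} \<and> x \<in> {0..1} \<and> c < (INF v\<in>cell y x. f v)}"
    have W: "(\<exists>S\<in>focal t. c < (INF v\<in>S. f v)) \<longleftrightarrow> t \<in> ?W" for t
    proof
      assume "\<exists>S\<in>focal t. c < (INF v\<in>S. f v)"
      then obtain y x where *: "y \<in> {-1..1}" "x \<in> {0..1}" "c < (INF v\<in>cell y x. f v)"
        and "U y < t" "t < G x"
        unfolding focal_def by blast
      then have "t \<in> {U y<..<G x}" by simp
      with * show "t \<in> ?W" by blast
    next
      assume "t \<in> ?W"
      then obtain y x where "y \<in> {-1..1}" "x \<in> {0..1}" "c < (INF v\<in>cell y x. f v)"
        and "t \<in> {U y<..<G x}" by blast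
      then show "\<exists>S\<in>focal t. c < (INF v\<in>S. f v)"
        by (intro bexI[of _ "cell y x"] focalI) auto
    qed
    have "t \<in> space ?M \<and> c < lower_limit_along (focal t) f \<longleftrightarrow> t \<in> ?W \<inter> {0<..<1}" for t
    proof (cases "t \<in> {0<..<1}")
      case True
      show ?thesis
        unfolding lower_limit_along_gt_iff[OF f filter_base_focal[OF True]] W
        using True by (simp add: space_restrict_space)
    qed (auto simp: space_restrict_space)
    then have "{t \<in> space ?M. c < lower_limit_along (focal t) f} = ?W \<inter> {0<..<1}" by blast
    moreover have "open (?W \<inter> {0<..<1})" by (intro open_Int open_Union) auto
    ultimately show "{t \<in> space ?M. c < lower_limit_along (focal t) f} \<in> sets ?M"
      by (simp add: sets_restrict_space_iff)
  qed
  ultimately have "coherent_lower_prevision (\<lambda>f. \<integral>t. lower_limit_along (focal t) f \<partial>?M)"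
    by (intro coherent_mixture coherent_lower_limit_along filter_base_focal)
      (auto simp: space_restrict_space)
  then show ?thesis by (simp add: focal_mixture_def[abs_def])
qed

lemma focal_mixture_event: "on_event focal_mixture A = measure lborel (levels A)"
proof -
  let ?M = "restrict_space lborel {0<..<1::real}"
  have "focal_mixture (indicator A) = (\<integral>t. indicator (levels A) t \<partial>?M)"
    unfolding focal_mixture_def
    by (intro Bochner_Integration.integral_cong refl)
      (simp add: space_restrict_space lower_limit_along_indicator[OF filter_base_focal]
        levels_iff indicator_def)
  also have "\<dots> = measure ?M (levels A)"
    using levels_subset[of A] by (simp add: Int_absorb2 space_restrict_space)
  also have "\<dots> = measure lborel (levels A)"
    by (rule measure_restrict_space) (use levels_subset in auto)
  finally show ?thesis by (simp add: on_event_def)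
qed

text \<open>Next come the two computations that make the mixture match the p-box. A nonempty cell \<open>(y, x]\<close>
  lies in \<open>[0, w]\<close> only if \<open>x \<le> w\<close>, so the best choice is \<open>x = w\<close> with \<open>U y = 0\<close>.\<close>

lemma levels_closed_interval: "levels (closed_interval Z bot\<^sub>\<Omega> w) = {0<..<Fl w}"
proof (intro equalityI subsetI)
  fix t assume t: "t \<in> levels (closed_interval Z bot\<^sub>\<Omega> w)"
  then obtain y x where *: "y \<in> {-1..1}" "x \<in> {0..1}" "cell y x \<subseteq> closed_interval Z bot\<^sub>\<Omega> w"
    "U y < t" "t < G x" "y < x" by (rule levelsE)
  obtain v where v: "Z v = x" using *(2) Z_surj by blast
  have "v \<in> cell y x" using *(6) v by (auto simp: cell_def)
  then have "x \<le> Z w" using *(3) v by (auto simp: closed_interval_def preceq_def)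
  then have "G x \<le> Fl w" using G_mono[of x "Z w"] *(2) Z_unit[of w] by simp
  then show "t \<in> {0<..<Fl w}" using t levels_subset[of "closed_interval Z bot\<^sub>\<Omega> w"] *(5) by auto
next
  fix t assume "t \<in> {0<..<Fl w}"
  moreover have "cell (-1) (Z w) \<subseteq> closed_interval Z bot\<^sub>\<Omega> w"
    using Z_bot Z_unit by (auto simp: cell_def closed_interval_def preceq_def)
  ultimately show "t \<in> levels (closed_interval Z bot\<^sub>\<Omega> w)"
    using Z_unit[of w] by (intro levelsI[of "-1" "Z w"]) auto
qed

text \<open>Dually, a nonempty cell \<open>(y, x]\<close> lies in \<open>(w, 1]\<close> only if \<open>w \<le> y\<close>.\<close>

lemma levels_left_open_interval: "levels (left_open_interval Z w top\<^sub>\<Omega>) = {Fu w<..<1}"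
proof (intro equalityI subsetI)
  fix t assume t: "t \<in> levels (left_open_interval Z w top\<^sub>\<Omega>)"
  then obtain y x where *: "y \<in> {-1..1}" "x \<in> {0..1}" "cell y x \<subseteq> left_open_interval Z w top\<^sub>\<Omega>"
    "U y < t" "t < G x" "y < x" by (rule levelsE)
  have "Z w \<le> y"
  proof (rule ccontr)
    assume "\<not> Z w \<le> y"
    have "min (Z w) x \<in> {0..1}" using Z_unit[of w] *(2) by auto
    then obtain v where "Z v = min (Z w) x" using Z_surj by blast
    then have "v \<in> cell y x" "\<not> Z w < Z v" using *(6) \<open>\<not> Z w \<le> y\<close> by (auto simp: cell_def)
    then show False using *(3) by (auto simp: left_open_interval_def prec_def)
  qed
  then have "Fu w \<le> U y" using U_mono[of y "Z w"] *(1) by simp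
  then show "t \<in> {Fu w<..<1}"
    using t levels_subset[of "left_open_interval Z w top\<^sub>\<Omega>"] *(4) by auto
next
  fix t assume "t \<in> {Fu w<..<1}"
  moreover have "cell (Z w) 1 \<subseteq> left_open_interval Z w top\<^sub>\<Omega>"
    using Z_top by (auto simp: cell_def left_open_interval_def preceq_def prec_def)
  moreover have "Z w \<in> {-1..1}" using Z_unit[of w] by auto
  ultimately show "t \<in> levels (left_open_interval Z w top\<^sub>\<Omega>)"
    by (intro levelsI[of "Z w" 1]) auto
qed

text \<open>The mixture is a competitor in the definition of the natural extension.\<close>

lemma natural_extension_le: "on_event E A \<le> measure lborel (levels A)"
proof -
  have "0 \<le> Fl w" "Fu w \<le> 1" for w
    using cdfs(1,2) by (auto simp: cdf_on_def image_subset_iff)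
  then have "matches_p_box Z bot\<^sub>\<Omega> top\<^sub>\<Omega> Fl Fu focal_mixture"
    by (simp add: matches_p_box_def focal_mixture_event levels_closed_interval
        levels_left_open_interval)
  then have "on_event E A \<le> on_event focal_mixture A"
    using nat_ext coherent_focal_mixture gamble_indicator
    unfolding is_natural_extension_def on_event_def by blast
  then show ?thesis by (simp add: focal_mixture_event)
qed

section \<open>Intervals\<close>

text \<open>The cell \<open>(y, x]\<close> is the intersection of \<open>[0, x]\<close> and \<open>(y, 1]\<close>, whose values are prescribed; for
  negative \<open>y\<close> it is \<open>[0, x]\<close> itself.\<close>

lemma cell_ge:
  assumes "y \<in> {-1..1}" "x \<in> {0..1}" "cell y x \<subseteq> A"
  shows "G x - U y \<le> on_event E A"
proof (cases "y < x")
  case False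
  then have "G x \<le> U y" using assms by (intro G_le_U) auto
  then show ?thesis using event_nonneg[OF E_coherent, of A] by simp
next
  case True
  obtain v where v: "Z v = x" using assms(2) Z_surj by blast
  have Ev: "on_event E (closed_interval Z bot\<^sub>\<Omega> v) = G x"
    using nat_ext v by (auto simp: is_natural_extension_def matches_p_box_def)
  have "G x - U y \<le> on_event E (cell y x)"
  proof (cases "y < 0")
    case y: True
    then have "cell y x = closed_interval Z bot\<^sub>\<Omega> v"
      using v Z_bot Z_unit by (fastforce simp: cell_def closed_interval_def preceq_def)
    then show ?thesis using Ev y by simp
  next
    case False
    then obtain w where w: "Z w = y" using assms(1) Z_surj[of y] by auto
    have "on_event E (left_open_interval Z w top\<^sub>\<Omega>) = 1 - U y"
      using nat_ext w by (auto simp: is_natural_extension_def matches_p_box_def)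
    moreover have "closed_interval Z bot\<^sub>\<Omega> v \<union> left_open_interval Z w top\<^sub>\<Omega> = UNIV"
      using True v w Z_bot Z_top Z_unit
      by (auto simp: closed_interval_def left_open_interval_def preceq_def prec_def)
    moreover have "closed_interval Z bot\<^sub>\<Omega> v \<inter> left_open_interval Z w top\<^sub>\<Omega> = cell y x"
      using v w Z_bot Z_top Z_unit
      by (auto simp: closed_interval_def left_open_interval_def preceq_def prec_def cell_def)
    ultimately show ?thesis
      using event_Int_ge[OF E_coherent, of "closed_interval Z bot\<^sub>\<Omega> v"
          "left_open_interval Z w top\<^sub>\<Omega>"] Ev by simp
  qed
  then show ?thesis using event_mono[OF E_coherent assms(3)] by linarith
qed

lemma cell_subset_vimage_iff:
  assumes "y \<in> {-1..1}" "x \<in> {0..1}"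
  shows "cell y x \<subseteq> Z -` I \<longleftrightarrow> {y<..x} \<inter> {0..1} \<subseteq> I"
proof
  assume *: "cell y x \<subseteq> Z -` I"
  show "{y<..x} \<inter> {0..1} \<subseteq> I"
  proof
    fix z assume z: "z \<in> {y<..x} \<inter> {0..1}"
    then obtain v where "Z v = z" using Z_surj by blast
    then show "z \<in> I" using * z by (auto simp: cell_def)
  qed
next
  show "{y<..x} \<inter> {0..1} \<subseteq> I \<Longrightarrow> cell y x \<subseteq> Z -` I"
    using Z_unit by (auto simp: cell_def)
qed

text \<open>Take two levels \<open>s\<close> and \<open>t\<close> of \<open>I\<close>, with cells \<open>(y, x]\<close> and \<open>(y', x']\<close>. Because \<open>I\<close> is full, the
  crossed cell \<open>(y', x]\<close> is again inside \<open>I\<close> (or empty), and \<open>cell_ge\<close> bounds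
  \<open>s - t < G x - U y'\<close>. So the lower probability of \<open>I\<close> bounds the diameter of its levels.\<close>

lemma measure_levels_full_le:
  assumes I: "full I"
  shows "measure lborel (levels (Z -` I)) \<le> on_event E (Z -` I)"
proof (rule measure_le_diameter)
  show "levels (Z -` I) \<in> sets lborel" using open_levels by auto
  show "0 \<le> on_event E (Z -` I)" by (rule event_nonneg[OF E_coherent])
  fix s t assume "s \<in> levels (Z -` I)" "t \<in> levels (Z -` I)"
  then obtain y x y' x' where *:
    "y \<in> {-1..1}" "x \<in> {0..1}" "cell y x \<subseteq> Z -` I" "s < G x" "y < x"
    "y' \<in> {-1..1}" "x' \<in> {0..1}" "cell y' x' \<subseteq> Z -` I" "U y' < t" "y' < x'"
    by (elim levelsE)
  then have xI: "x \<in> I" "x' \<in> I" using * by (auto simp: cell_subset_vimage_iff)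
  have "z \<in> I" if z: "z \<in> {y'<..x} \<inter> {0..1}" for z
  proof (cases "z \<le> x'")
    case True
    then show ?thesis using *(6-8) z by (auto simp: cell_subset_vimage_iff)
  next
    case False
    then have "{x'..x} \<subseteq> I" using I xI z unfolding full_def by auto
    then show ?thesis using z False by auto
  qed
  then have "G x - U y' \<le> on_event E (Z -` I)"
    using * by (intro cell_ge) (auto simp: cell_subset_vimage_iff)
  then show "s - t \<le> on_event E (Z -` I)" using * by linarith
qed

text \<open>The largest cells inside \<open>I\<close> start at \<open>Inf I\<close>, or below \<open>0\<close> when \<open>I\<close> contains \<open>0\<close>, and end at a
  point of \<open>I\<close> close to \<open>Sup I\<close>. They bound the lower probability of \<open>I\<close> from below, in the limit by
  left-continuity, and they bound the levels of \<open>I\<close> and thereby the lower probability from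
  above.\<close>

lemma event_full_eq:
  assumes I: "full I" "I \<noteq> {}" and cont: "left_continuous_on_unit G"
  shows "on_event E (Z -` I) = interval_term0 G (as_fun_of_z Z Fu) I"
proof -
  have I01: "I \<subseteq> {0..1}" using I by (simp add: full_def)
  then have bdd: "bdd_above I" "bdd_below I" by (meson bdd_above_Icc bdd_above_mono bdd_below_Icc bdd_below_mono)+
  define s where "s = Sup I"
  define a where "a = (if 0 \<in> I then -1 else Inf I)"
  have s: "s \<in> {0..1}" "\<And>x. x \<in> I \<Longrightarrow> x \<le> s"
  proof -
    show le: "x \<le> s" if "x \<in> I" for x using that bdd by (auto simp: s_def intro: cSup_upper)
    obtain x where "x \<in> I" using I(2) by auto
    moreover have "s \<le> 1" unfolding s_def using I(2) I01 by (intro cSup_least) auto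
    ultimately show "s \<in> {0..1}" using le[of x] I01 by force
  qed
  have Inf01: "Inf I \<in> {0..1}"
  proof -
    obtain x where "x \<in> I" using I(2) by auto
    then have "Inf I \<le> x" "x \<le> 1" using bdd I01 by (auto intro: cInf_lower)
    moreover have "0 \<le> Inf I" using I(2) I01 by (intro cInf_greatest) auto
    ultimately show ?thesis by auto
  qed
  then have a: "a \<in> {-1..1}" by (auto simp: a_def)
  have Ua: "U a = (if 0 \<in> I then 0 else as_fun_of_z Z Fu (Inf I))"
    using Inf01 by (auto simp: a_def U_def)
  \<comment> \<open>Cells omit their lower end, so \<open>(a, x]\<close> stays in \<open>I\<close> whether or not \<open>Inf I\<close> belongs to
    \<open>I\<close>.\<close>
  have ge: "G x - U a \<le> on_event E (Z -` I)" if x: "x \<in> I" for x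
  proof -
    have "z \<in> I" if z: "z \<in> {a<..x} \<inter> {0..1}" for z
    proof -
      obtain b where "b \<in> I" "b \<le> z"
        using z cInf_less_iff[OF I(2) bdd(2), of z]
        by (cases "0 \<in> I") (auto simp: a_def intro: less_imp_le)
      then have "{b..x} \<subseteq> I" using I(1) x z unfolding full_def by auto
      then show ?thesis using \<open>b \<le> z\<close> z by auto
    qed
    then have "cell a x \<subseteq> Z -` I" using a x I01 by (subst cell_subset_vimage_iff) auto
    then show ?thesis using a x I01 by (intro cell_ge) auto
  qed
  have "G s \<le> on_event E (Z -` I) + U a"
  proof (cases "s \<in> I")
    case True
    then show ?thesis using ge[of s] by simp
  next
    case False
    obtain x0 where x0: "x0 \<in> I" using I(2) by auto
    then have x0s: "x0 < s" "0 \<le> x0" using s(2)[of x0] False I01 by (auto simp: less_le)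
    have "(G \<longlongrightarrow> G s) (at s within {0..s})"
      using cont s(1) by (auto simp: left_continuous_on_unit_def continuous_within)
    moreover have "eventually (\<lambda>x. G x \<le> on_event E (Z -` I) + U a) (at s within {0..s})"
      unfolding eventually_at
    proof (intro exI[of _ "s - x0"] conjI ballI impI)
      fix x assume x: "x \<in> {0..s}" "x \<noteq> s \<and> dist x s < s - x0"
      then obtain x1 where "x1 \<in> I" "x < x1"
        using less_cSup_iff[OF I(2) bdd(1), of x] by (auto simp: s_def)
      moreover have "x0 < x" using x by (auto simp: dist_real_def)
      ultimately have "x \<in> I" using I(1) x0 unfolding full_def
        by (meson atLeastAtMost_iff less_imp_le order_trans subsetD)
      then show "G x \<le> on_event E (Z -` I) + U a" using ge[of x] by simp
    qed (use x0s in simp)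
    moreover have "at s within {0..s} \<noteq> bot"
      using x0s at_within_Icc_at_left[of 0 s] by simp
    ultimately show ?thesis by (rule tendsto_upperbound)
  qed
  then have lower: "max 0 (G s - U a) \<le> on_event E (Z -` I)"
    using event_nonneg[OF E_coherent, of "Z -` I"] by simp
  have "levels (Z -` I) \<subseteq> {U a..G s}"
  proof
    fix t assume "t \<in> levels (Z -` I)"
    then obtain y x where *: "y \<in> {-1..1}" "x \<in> {0..1}" "cell y x \<subseteq> Z -` I" "U y < t" "t < G x"
      "y < x" by (rule levelsE)
    have sub: "{y<..x} \<inter> {0..1} \<subseteq> I" using * by (simp add: cell_subset_vimage_iff)
    then have "x \<in> I" using * by auto
    then have "G x \<le> G s" using * s by (intro G_mono) auto
    moreover have "U a \<le> U y"
    proof (cases "0 \<in> I")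
      case True
      then show ?thesis using U_bounds by (simp add: a_def)
    next
      case False
      then have y: "0 \<le> y" using subsetD[OF sub, of 0] * by (cases "y < 0") auto
      have "Inf I \<le> y"
      proof (rule dense_ge_bounded[OF *(6)])
        fix z assume "y < z" "z < x"
        then have "z \<in> I" using subsetD[OF sub, of z] y * by auto
        then show "Inf I \<le> z" using bdd by (intro cInf_lower)
      qed
      then show ?thesis using * False by (intro U_mono) (auto simp: a_def)
    qed
    ultimately show "t \<in> {U a..G s}" using * by auto
  qed
  then have "measure lborel (levels (Z -` I)) \<le> measure lborel {U a..G s}"
    using open_levels by (intro measure_mono_fmeasurable fmeasurable_compact) auto
  also have "\<dots> = max 0 (G s - U a)" by (cases "U a \<le> G s") auto
  finally have "on_event E (Z -` I) \<le> max 0 (G s - U a)"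
    using natural_extension_le[of "Z -` I"] by linarith
  then have "on_event E (Z -` I) = max 0 (G s - U a)" using lower by (rule antisym)
  then show ?thesis unfolding Ua interval_term0_def s_def .
qed

section \<open>Arbitrary events\<close>

lemma image_partition_interior: "Z ` partition_interior Z A = Gamma_lower Z A"
proof (intro equalityI subsetI)
  fix z assume "z \<in> Z ` partition_interior Z A"
  then show "z \<in> Gamma_lower Z A"
    using Z_unit by (fastforce simp: partition_interior_def eq_class_def Gamma_lower_def)
next
  fix z assume z: "z \<in> Gamma_lower Z A"
  then obtain v where v: "Z v = z" using Z_surj by (auto simp: Gamma_lower_def)
  then have "eq_class Z v \<subseteq> A" "v \<in> eq_class Z v" using z by (auto simp: eq_class_def Gamma_lower_def)
  then have "v \<in> partition_interior Z A" unfolding partition_interior_def by blast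
  then show "z \<in> Z ` partition_interior Z A" using v by blast
qed

lemma partition_interior_Compl: "partition_interior Z (- A) = - partition_closure Z A"
proof (intro equalityI subsetI)
  fix v assume "v \<in> - partition_closure Z A"
  then have "eq_class Z v \<inter> A = {}" by (auto simp: partition_closure_def eq_class_def)
  then have "eq_class Z v \<subseteq> - A" "v \<in> eq_class Z v" by (auto simp: eq_class_def)
  then show "v \<in> partition_interior Z (- A)" unfolding partition_interior_def by blast
qed (auto simp: partition_interior_def partition_closure_def eq_class_def)

lemma Gamma_lower_unit: "Gamma_lower Z A \<subseteq> {0..1}"
  by (auto simp: Gamma_lower_def)

lemma full_full_components: "I \<in> full_components (Gamma_lower Z A) \<Longrightarrow> full I"
  using full_component_greatest(1)[OF Gamma_lower_unit] by (auto simp: full_components_def)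

lemma full_components_nonempty: "I \<in> full_components (Gamma_lower Z A) \<Longrightarrow> I \<noteq> {}"
  using full_component_greatest(2)[OF Gamma_lower_unit] by (force simp: full_components_def)

lemma full_components_subset: "I \<in> full_components (Gamma_lower Z A) \<Longrightarrow> I \<subseteq> Gamma_lower Z A"
  using full_component_greatest(3)[OF Gamma_lower_unit] unfolding full_components_def by blast

lemma vimage_full_component_subset: "I \<in> full_components (Gamma_lower Z A) \<Longrightarrow> Z -` I \<subseteq> A"
  by (drule full_components_subset) (auto simp: Gamma_lower_def)

text \<open>A nonempty cell \<open>(y, x]\<close> inside \<open>A\<close> is a full part of \<open>\<Gamma>\<^sub>*(A)\<close> and thus belongs to the component
  of its point \<open>x\<close>.\<close>

lemma levels_subset_UN_components:
  "levels A \<subseteq> (\<Union>I\<in>full_components (Gamma_lower Z A). levels (Z -` I))"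
proof
  fix t assume "t \<in> levels A"
  then obtain y x where *: "y \<in> {-1..1}" "x \<in> {0..1}" "cell y x \<subseteq> A" "U y < t" "t < G x" "y < x"
    by (rule levelsE)
  let ?S = "{y<..x} \<inter> {0..1}"
  have S: "full ?S" "x \<in> ?S" using * by (auto simp: full_def)
  have sub: "?S \<subseteq> Gamma_lower Z A"
    using *(3) by (auto simp: Gamma_lower_def cell_def)
  then have x: "x \<in> Gamma_lower Z A" using S by blast
  define I where "I = full_component (Gamma_lower Z A) x"
  have "?S \<subseteq> I" unfolding I_def
    using full_component_greatest(4)[OF Gamma_lower_unit x S sub] .
  then have "cell y x \<subseteq> Z -` I" using * by (simp add: cell_subset_vimage_iff)
  then have "t \<in> levels (Z -` I)" using * by (intro levelsI)
  moreover have "I \<in> full_components (Gamma_lower Z A)"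
    using x by (simp add: I_def full_components_def)
  ultimately show "t \<in> (\<Union>I\<in>full_components (Gamma_lower Z A). levels (Z -` I))" by blast
qed

lemma event_eq_sum_components:
  "ereal (on_event E A) = sum_sup (\<lambda>I. on_event E (Z -` I)) (full_components (Gamma_lower Z A))"
proof (rule sum_sup_eqI[symmetric])
  let ?C = "full_components (Gamma_lower Z A)"
  fix K assume K: "finite K" "K \<subseteq> ?C"
  have "disjoint_family_on (\<lambda>I. Z -` I) K"
    using K full_components_disjoint[OF Gamma_lower_unit[of A]] unfolding disjoint_family_on_def by blast
  then show "(\<Sum>I\<in>K. on_event E (Z -` I)) \<le> on_event E A"
    using K by (intro sum_disjoint_events_le[OF E_coherent] vimage_full_component_subset) auto
next
  let ?C = "full_components (Gamma_lower Z A)"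
  fix b assume b: "\<And>K. finite K \<Longrightarrow> K \<subseteq> ?C \<Longrightarrow> (\<Sum>I\<in>K. on_event E (Z -` I)) \<le> b"
  \<comment> \<open>There may be uncountably many components, so countable subadditivity needs a countable
    subcover first.\<close>
  have "\<And>T. T \<in> (\<lambda>I. levels (Z -` I)) ` ?C \<Longrightarrow> open T" using open_levels by auto
  then obtain \<D> where \<D>: "\<D> \<subseteq> (\<lambda>I. levels (Z -` I)) ` ?C" "countable \<D>"
    "\<Union>\<D> = (\<Union>I\<in>?C. levels (Z -` I))"
    by (rule Lindelof) auto
  have fin: "measure lborel (\<Union>\<E>) \<le> b" if \<E>: "\<E> \<subseteq> \<D>" "finite \<E>" for \<E>
  proof -
    obtain K where K: "K \<subseteq> ?C" "finite K" "\<E> = (\<lambda>I. levels (Z -` I)) ` K"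
      using finite_subset_image[OF \<E>(2)] \<E>(1) \<D>(1) by (metis subset_trans)
    have "measure lborel (\<Union>\<E>) \<le> (\<Sum>I\<in>K. measure lborel (levels (Z -` I)))"
      unfolding K(3) using K(2) by (intro measure_UNION_le fmeasurableD levels_fmeasurable)
    also have "\<dots> \<le> (\<Sum>I\<in>K. on_event E (Z -` I))"
      using K(1) full_full_components by (intro sum_mono measure_levels_full_le) auto
    finally show ?thesis using b[OF K(2,1)] by simp
  qed
  have \<D>m: "T \<in> fmeasurable lborel" if "T \<in> \<D>" for T
    using that \<D>(1) levels_fmeasurable by auto
  have "on_event E A \<le> measure lborel (levels A)" by (rule natural_extension_le)
  also have "\<dots> \<le> measure lborel (\<Union>\<D>)"
    using levels_subset_UN_components[of A] fmeasurable_Union_bound[OF \<D>(2) \<D>m fin]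
    unfolding \<D>(3) by (intro measure_mono_fmeasurable fmeasurableD[OF levels_fmeasurable])
  also have "\<dots> \<le> b"
    using \<D>(2) \<D>m fin by (rule measure_Union_bound)
  finally show "on_event E A \<le> b" .
qed

lemma event_eq_sum_interval_terms:
  assumes "left_continuous_on_unit G"
  shows "ereal (on_event E A) =
    sum_sup (interval_term0 G (as_fun_of_z Z Fu)) (full_components (Gamma_lower Z A))"
  unfolding event_eq_sum_components[of A]
  by (intro sum_sup_cong event_full_eq full_full_components full_components_nonempty assms)

text \<open>The convention for components that contain \<open>0\<close> only matters if there is one and \<open>Fu\<close> does not
  vanish at \<open>0\<close>.\<close>

lemma sum_sup_interval_term0:
  assumes "as_fun_of_z Z Fu 0 = 0 \<or> 0 \<notin> Gamma_lower Z A"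
  shows "sum_sup (interval_term0 G (as_fun_of_z Z Fu)) (full_components (Gamma_lower Z A)) =
    sum_sup (\<lambda>I. max 0 (G (Sup I) - as_fun_of_z Z Fu (Inf I))) (full_components (Gamma_lower Z A))"
proof (rule sum_sup_cong)
  fix I assume I: "I \<in> full_components (Gamma_lower Z A)"
  show "interval_term0 G (as_fun_of_z Z Fu) I = max 0 (G (Sup I) - as_fun_of_z Z Fu (Inf I))"
  proof (cases "0 \<in> I")
    case True
    then have "0 \<in> Gamma_lower Z A"
      using full_components_subset[OF I] by blast
    moreover have "Inf I = 0"
      using True full_full_components[OF I] by (intro cInf_eq_minimum) (auto simp: full_def)
    ultimately show ?thesis using assms True by (simp add: interval_term0_def)
  qed (simp add: interval_term0_def)
qed

end

theorem theorem20:
  fixes Z :: "'a \<Rightarrow> real" and bot\<^sub>\<Omega> top\<^sub>\<Omega> :: 'a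
    and Fl Fu :: "'a \<Rightarrow> real" and E :: "('a \<Rightarrow> real) \<Rightarrow> real" and A :: "'a set"
  assumes "range Z = {0..1}" and "Z bot\<^sub>\<Omega> = 0" and "Z top\<^sub>\<Omega> = 1"
    and "p_box Z top\<^sub>\<Omega> Fl Fu"
    and "is_natural_extension Z bot\<^sub>\<Omega> top\<^sub>\<Omega> Fl Fu E"
  shows
    "Z ` partition_interior Z A = Gamma_lower Z A \<and>
     Z ` partition_interior Z (- A) = Z ` (- partition_closure Z A) \<and>
     Z ` (- partition_closure Z A) = Gamma_lower Z (- A) \<and>
     ereal (on_event E A) =
       sum_sup (\<lambda>I. on_event E (Z -` I)) (full_components (Z ` partition_interior Z A)) \<and>
     ereal (on_event (conjugate E) A) =
       1 - sum_sup (\<lambda>J. on_event E (Z -` J)) (full_components (Z ` partition_interior Z (- A))) \<and>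
     (left_continuous_on_unit (as_fun_of_z Z Fl) \<and> as_fun_of_z Z Fl 0 = 0 \<longrightarrow>
        ereal (on_event E A) =
          sum_sup (interval_term0 (as_fun_of_z Z Fl) (as_fun_of_z Z Fu))
            (full_components (Z ` partition_interior Z A)) \<and>
        ereal (on_event (conjugate E) A) =
          1 - sum_sup (interval_term0 (as_fun_of_z Z Fl) (as_fun_of_z Z Fu))
            (full_components (Z ` partition_interior Z (- A))) \<and>
        (as_fun_of_z Z Fu 0 = 0 \<or> 0 \<notin> Z ` partition_interior Z A \<longrightarrow>
           ereal (on_event E A) =
             sum_sup (\<lambda>I. max 0 (as_fun_of_z Z Fl (Sup I) - as_fun_of_z Z Fu (Inf I)))
               (full_components (Z ` partition_interior Z A))) \<and>
        (as_fun_of_z Z Fu 0 = 0 \<or> 0 \<notin> Z ` partition_interior Z (- A) \<longrightarrow>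
           ereal (on_event (conjugate E) A) =
             1 - sum_sup (\<lambda>J. max 0 (as_fun_of_z Z Fl (Sup J) - as_fun_of_z Z Fu (Inf J)))
               (full_components (Z ` partition_interior Z (- A)))))"
proof -
  interpret p_box_extension Z bot\<^sub>\<Omega> top\<^sub>\<Omega> Fl Fu E
    by unfold_locales (fact assms)+
  have conj: "ereal (on_event (conjugate E) A) = 1 - ereal (on_event E (- A))"
    by (simp add: conjugate_event[OF E_coherent] one_ereal_def)
  show ?thesis
    unfolding partition_interior_Compl[symmetric] image_partition_interior conj
    using event_eq_sum_components[of A] event_eq_sum_components[of "- A"]
      event_eq_sum_interval_terms[of A] event_eq_sum_interval_terms[of "- A"]
      sum_sup_interval_term0[of A] sum_sup_interval_term0[of "- A"]
    by (intro conjI impI) simp_all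
qed

end
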